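(* Let $P=(P_1,\dots,P_n)$ be a stratified Datalog program, possibly with generalized literals, and let $U$ be a universe for $P$. Then there is a unique $M$ such that $(U,M)$ is an open answer set of $P$, and $M$ is identical to the least fixed point model of $P$ with input structure $\mathrm{id}(U)$ minus the equality atoms.
   Context: **Generalized programs and open answer sets.** Terms are constants and variables (no function symbols). A literal is an atom $q(\mathbf{t})$ or a naf-atom $\mathrm{not}\,q(\mathbf{t})$. Equality is a binary predicate; $t\neq s$ stands for $\mathrm{not}\,(t=s)$. A regular atom is an atom that is not an equality atom. A generalized literal here is a formula $\forall\mathbf{Y}.\,a\Rightarrow b$ with $a,b$ atoms. For a set $\beta$ of literals and generalized literals, $\beta^{\mathrm{x}}$ is its set of generalized literals, $\beta^+$ its set of atoms, $\beta^-=\{a\mid\mathrm{not}\,a\in\beta\}$. A universe $U$ for $P$ is a non-empty countable superset of the constants of $P$; $P_U$ is obtained by substituting the (free) variables of rules of $P$ by elements of $U$ in all possible ways. For a set $I$ of ground regular atoms, $I\models a$ iff $a\in I$ for regular $a$; $I\models t=s$ iff $t,s$ are the same element; $I\models\mathrm{not}\,a$ iff $I\not\models a$. The GeLi-reduct $Q^{\mathrm{x}(U,I)}$ of a ground program $Q$ consists of the rules $\alpha\leftarrow(\beta\setminus\beta^{\mathrm{x}}),\ \bigcup_{\forall\mathbf{Y}.a\Rightarrow b\,\in\,\beta^{\mathrm{x}}}\{b[\mathbf{Y}|\mathbf{y}]\mid\mathbf{y}\subseteq U,\ I\models a[\mathbf{Y}|\mathbf{y}]\}$ for $\alpha\leftarrow\beta\in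 Q$. For a ground program $Q$ without generalized literals (bodies possibly infinite), $Q^I=\{\alpha^+\leftarrow\beta^+\mid\alpha\leftarrow\beta\in Q,\ I\models\mathrm{not}\,\beta^-,\ I\models\alpha^-\}$, and $I$ is an answer set of $Q$ if $I$ is a subset-minimal model of $Q^I$. An open answer set of $P$ is a pair $(U,M)$, $U$ a universe for $P$, $M$ a set of ground regular atoms over the predicates of $P$ and $U$, with $M$ an answer set of $(P_U)^{\mathrm{x}(U,M)}$. **Stratified Datalog.** A Datalog rule is a rule $a\leftarrow\beta$ with head a single regular atom $a$, and $\beta$ a finite set of literals and (if generalized literals are allowed) generalized literals. A basic Datalog program is a finite set of Datalog rules in which no head predicate occurs in a negative body or as the predicate of the antecedent $a$ of a generalized literal $\forall\mathbf{Y}.a\Rightarrow b$. Predicates that occur only in rule bodies (including in generalized literals) are extensional; equality is always extensional; $\mathrm{edb}(P)$ is the set of extensional predicates of $P$. A stratified Datalog program is a union of basic Datalog programs $(P_1,\dots,P_n)$ (strata) such that each head predicate of $P$ is a head predicate in exactly one stratum, and whenever a head predicate in $P_i$ is extensional in $P_j$ then $i<j$. (So predicates under $\mathrm{not}$ or in antecedents of generalized literals that are head predicates belong to strictly lower strata; those in positive bodies or consequents to the same or lower strata.) $\mathrm{id}(U)=\{x=x\mid x\in U\}$. For an input structure $\mathcal{U}$ over the extensional predicates of $P$ (a set of ground atoms over $U$, with equality interpreted as $\mathrm{id}(U)$), put $\mathcal{U}_0=\mathcal{U}$ and $\mathcal{U}_i=\mathcal{U}_{i-1}\cup S_i$, where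 $S_i$ is the minimal model (over domain $U$) of the first-order clauses $\Sigma_{P_i}$ corresponding to the rules of $P_i$ (universally quantified implications, $\mathrm{not}$ read as $\neg$) among those models whose restriction to $\mathrm{edb}(P_i)$ equals $\mathcal{U}_{i-1}|\mathrm{edb}(P_i)$; here a generalized literal $\forall\mathbf{Y}.a\Rightarrow b$ is, for each grounding of its free variables, instantiated by the conjunction of the $b[\mathbf{Y}|\mathbf{y}]$ for which $a[\mathbf{Y}|\mathbf{y}]$ is true ($a$ being extensional in $P_i$). The least fixed point model of $P$ with input $\mathcal{U}$ is $\mathcal{U}_n$. *)

theory Defs
  imports Main "HOL-Library.Countable_Set"
begin

section \<open>Syntax\<close>

text \<open>Constants and universe elements share the type \<open>'c\<close>: a universe is a set of
  \<open>'c\<close> that contains the constants of the program and possibly further elements.\<close>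

datatype ('c, 'v) trm = Const 'c | Var 'v

datatype ('p, 'c, 'v) atom =
    Rel 'p "('c, 'v) trm list"
  | Eq "('c, 'v) trm" "('c, 'v) trm"

datatype 'p predicate = Pred 'p | Equality

datatype ('p, 'c, 'v) literal = Pos "('p, 'c, 'v) atom" | Naf "('p, 'c, 'v) atom"

text \<open>\<open>Gen Y a b\<close> is the generalized literal \<open>\<forall>Y. a \<Rightarrow> b\<close>; it binds the variables
  in \<open>Y\<close>, all other variables of \<open>a\<close> and \<open>b\<close> are free.\<close>

datatype ('p, 'c, 'v) body_literal =
    Lit "('p, 'c, 'v) literal"
  | Gen "'v list" "('p, 'c, 'v) atom" "('p, 'c, 'v) atom"

datatype ('p, 'c, 'v) rule =
  Rule (head: "('p, 'c, 'v) literal set") (body: "('p, 'c, 'v) body_literal set")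

type_synonym ('p, 'c, 'v) program = "('p, 'c, 'v) rule set"

fun pred_of :: "('p, 'c, 'v) atom \<Rightarrow> 'p predicate" where
  "pred_of (Rel q ts) = Pred q"
| "pred_of (Eq t s) = Equality"

fun atom_terms :: "('p, 'c, 'v) atom \<Rightarrow> ('c, 'v) trm set" where
  "atom_terms (Rel q ts) = set ts"
| "atom_terms (Eq t s) = {t, s}"

fun literal_atom :: "('p, 'c, 'v) literal \<Rightarrow> ('p, 'c, 'v) atom" where
  "literal_atom (Pos a) = a"
| "literal_atom (Naf a) = a"

fun body_literal_atoms :: "('p, 'c, 'v) body_literal \<Rightarrow> ('p, 'c, 'v) atom set" where
  "body_literal_atoms (Lit l) = {literal_atom l}"
| "body_literal_atoms (Gen Y a b) = {a, b}"

definition head_atoms :: "('p, 'c, 'v) program \<Rightarrow> ('p, 'c, 'v) atom set" where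
  "head_atoms P = (\<Union>r\<in>P. literal_atom ` head r)"

definition body_atoms :: "('p, 'c, 'v) program \<Rightarrow> ('p, 'c, 'v) atom set" where
  "body_atoms P = (\<Union>r\<in>P. \<Union>(body_literal_atoms ` body r))"

definition head_preds :: "('p, 'c, 'v) program \<Rightarrow> 'p predicate set" where
  "head_preds P = pred_of ` head_atoms P"

definition body_preds :: "('p, 'c, 'v) program \<Rightarrow> 'p predicate set" where
  "body_preds P = pred_of ` body_atoms P"

definition preds :: "('p, 'c, 'v) program \<Rightarrow> 'p predicate set" where
  "preds P = head_preds P \<union> body_preds P"

definition constants :: "('p, 'c, 'v) program \<Rightarrow> 'c set" where
  "constants P = {c. \<exists>a \<in> head_atoms P \<union> body_atoms P. Const c \<in> atom_terms a}"

definition respects_arity :: "('p \<Rightarrow> nat) \<Rightarrow> ('p, 'c, 'v) program \<Rightarrow> bool" where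
  "respects_arity ar P \<longleftrightarrow>
     (\<forall>q ts. Rel q ts \<in> head_atoms P \<union> body_atoms P \<longrightarrow> length ts = ar q)"

section \<open>Grounding\<close>

text \<open>Only the variables in \<open>V\<close> are replaced.\<close>

fun subst_trm :: "'v set \<Rightarrow> ('v \<Rightarrow> 'c) \<Rightarrow> ('c, 'v) trm \<Rightarrow> ('c, 'v) trm" where
  "subst_trm V \<sigma> (Const c) = Const c"
| "subst_trm V \<sigma> (Var x) = (if x \<in> V then Const (\<sigma> x) else Var x)"

fun subst_atom :: "'v set \<Rightarrow> ('v \<Rightarrow> 'c) \<Rightarrow> ('p, 'c, 'v) atom \<Rightarrow> ('p, 'c, 'v) atom" where
  "subst_atom V \<sigma> (Rel q ts) = Rel q (map (subst_trm V \<sigma>) ts)"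
| "subst_atom V \<sigma> (Eq t s) = Eq (subst_trm V \<sigma> t) (subst_trm V \<sigma> s)"

fun ground_literal :: "('v \<Rightarrow> 'c) \<Rightarrow> ('p, 'c, 'v) literal \<Rightarrow> ('p, 'c, 'v) literal" where
  "ground_literal \<sigma> (Pos a) = Pos (subst_atom UNIV \<sigma> a)"
| "ground_literal \<sigma> (Naf a) = Naf (subst_atom UNIV \<sigma> a)"

fun ground_body_literal ::
  "('v \<Rightarrow> 'c) \<Rightarrow> ('p, 'c, 'v) body_literal \<Rightarrow> ('p, 'c, 'v) body_literal" where
  "ground_body_literal \<sigma> (Lit l) = Lit (ground_literal \<sigma> l)"
| "ground_body_literal \<sigma> (Gen Y a b) =
     Gen Y (subst_atom (- set Y) \<sigma> a) (subst_atom (- set Y) \<sigma> b)"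

definition ground_rule :: "('v \<Rightarrow> 'c) \<Rightarrow> ('p, 'c, 'v) rule \<Rightarrow> ('p, 'c, 'v) rule" where
  "ground_rule \<sigma> r = Rule (ground_literal \<sigma> ` head r) (ground_body_literal \<sigma> ` body r)"

definition grounding :: "('p, 'c, 'v) program \<Rightarrow> 'c set \<Rightarrow> ('p, 'c, 'v) program" where
  "grounding P U = {ground_rule \<sigma> r | \<sigma> r. r \<in> P \<and> range \<sigma> \<subseteq> U}"

section \<open>Open answer sets\<close>

definition universe :: "('p, 'c, 'v) program \<Rightarrow> 'c set \<Rightarrow> bool" where
  "universe P U \<longleftrightarrow> U \<noteq> {} \<and> countable U \<and> constants P \<subseteq> U"

definition ground_regular ::
  "('p \<Rightarrow> nat) \<Rightarrow> 'p predicate set \<Rightarrow> 'c set \<Rightarrow> ('p, 'c, 'v) atom set" where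
  "ground_regular ar \<Pi> U =
     {Rel q ts | q ts. Pred q \<in> \<Pi> \<and> length ts = ar q \<and> set ts \<subseteq> Const ` U}"

fun sat_atom :: "('p, 'c, 'v) atom set \<Rightarrow> ('p, 'c, 'v) atom \<Rightarrow> bool" where
  "sat_atom I (Rel q ts) \<longleftrightarrow> Rel q ts \<in> I"
| "sat_atom I (Eq t s) \<longleftrightarrow> t = s"

definition geli_reduct ::
  "('p, 'c, 'v) program \<Rightarrow> 'c set \<Rightarrow> ('p, 'c, 'v) atom set \<Rightarrow> ('p, 'c, 'v) program" where
  "geli_reduct Q U I =
     (\<lambda>r. Rule (head r)
            ((body r \<inter> range Lit) \<union>
             {Lit (Pos (subst_atom (set Y) \<tau> b)) | Y a b \<tau>.
                Gen Y a b \<in> body r \<and> range \<tau> \<subseteq> U \<and>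
                sat_atom I (subst_atom (set Y) \<tau> a)})) ` Q"

text \<open>The Gelfond-Lifschitz reduct consists of positive rules, represented as pairs of
  a set of head atoms and a set of body atoms. It is meant for ground programs without
  generalized literals.\<close>

definition gl_reduct ::
  "('p, 'c, 'v) program \<Rightarrow> ('p, 'c, 'v) atom set \<Rightarrow>
     (('p, 'c, 'v) atom set \<times> ('p, 'c, 'v) atom set) set" where
  "gl_reduct Q I =
     {({a. Pos a \<in> head r}, {a. Lit (Pos a) \<in> body r}) | r. r \<in> Q \<and>
        (\<forall>a. Lit (Naf a) \<in> body r \<longrightarrow> \<not> sat_atom I a) \<and>
        (\<forall>a. Naf a \<in> head r \<longrightarrow> sat_atom I a)}"

definition positive_model ::
  "('p, 'c, 'v) atom set \<Rightarrow> (('p, 'c, 'v) atom set \<times> ('p, 'c, 'v) atom set) set \<Rightarrow> bool" where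
  "positive_model I R \<longleftrightarrow>
     (\<forall>(\<alpha>, \<beta>) \<in> R. (\<forall>a\<in>\<beta>. sat_atom I a) \<longrightarrow> (\<exists>a\<in>\<alpha>. sat_atom I a))"

definition answer_set :: "('p, 'c, 'v) program \<Rightarrow> ('p, 'c, 'v) atom set \<Rightarrow> bool" where
  "answer_set Q I \<longleftrightarrow>
     positive_model I (gl_reduct Q I) \<and>
     (\<forall>J. J \<subset> I \<longrightarrow> \<not> positive_model J (gl_reduct Q I))"

definition open_answer_set ::
  "('p \<Rightarrow> nat) \<Rightarrow> ('p, 'c, 'v) program \<Rightarrow> 'c set \<Rightarrow> ('p, 'c, 'v) atom set \<Rightarrow> bool" where
  "open_answer_set ar P U M \<longleftrightarrow>
     universe P U \<and> M \<subseteq> ground_regular ar (preds P) U \<and>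
     answer_set (geli_reduct (grounding P U) U M) M"

section \<open>Stratified Datalog programs\<close>

definition edb :: "('p, 'c, 'v) program \<Rightarrow> 'p predicate set" where
  "edb P = insert Equality (body_preds P - head_preds P)"

definition datalog_rule :: "('p, 'c, 'v) rule \<Rightarrow> bool" where
  "datalog_rule r \<longleftrightarrow> (\<exists>q ts. head r = {Pos (Rel q ts)}) \<and> finite (body r)"

definition basic_datalog :: "('p, 'c, 'v) program \<Rightarrow> bool" where
  "basic_datalog P \<longleftrightarrow>
     finite P \<and> (\<forall>r\<in>P. datalog_rule r) \<and>
     (\<forall>r\<in>P. \<forall>a. Lit (Naf a) \<in> body r \<longrightarrow> pred_of a \<notin> head_preds P) \<and>
     (\<forall>r\<in>P. \<forall>Y a b. Gen Y a b \<in> body r \<longrightarrow> pred_of a \<notin> head_preds P)"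

definition stratified_datalog :: "('p, 'c, 'v) program list \<Rightarrow> bool" where
  "stratified_datalog Ps \<longleftrightarrow>
     (\<forall>Q \<in> set Ps. basic_datalog Q) \<and>
     (\<forall>q \<in> head_preds (\<Union>(set Ps)). \<exists>!i. i < length Ps \<and> q \<in> head_preds (Ps ! i)) \<and>
     (\<forall>i < length Ps. \<forall>j < length Ps.
        head_preds (Ps ! i) \<inter> edb (Ps ! j) \<noteq> {} \<longrightarrow> i < j)"

section \<open>Least fixed point models\<close>

text \<open>A structure is a set of ground atoms that, unlike an open answer set, contains the
  equality atoms explicitly.\<close>

definition id_structure :: "'c set \<Rightarrow> ('p, 'c, 'v) atom set" where
  "id_structure U = {Eq (Const x) (Const x) | x. x \<in> U}"

definition is_structure ::
  "('p \<Rightarrow> nat) \<Rightarrow> 'p predicate set \<Rightarrow> 'c set \<Rightarrow> ('p, 'c, 'v) atom set \<Rightarrow> bool" where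
  "is_structure ar \<Pi> U S \<longleftrightarrow> (\<exists>R \<subseteq> ground_regular ar \<Pi> U. S = id_structure U \<union> R)"

definition restrict ::
  "('p, 'c, 'v) atom set \<Rightarrow> 'p predicate set \<Rightarrow> ('p, 'c, 'v) atom set" where
  "restrict S \<Pi> = {a \<in> S. pred_of a \<in> \<Pi>}"

fun fo_literal :: "('p, 'c, 'v) atom set \<Rightarrow> ('p, 'c, 'v) literal \<Rightarrow> bool" where
  "fo_literal S (Pos a) \<longleftrightarrow> a \<in> S"
| "fo_literal S (Naf a) \<longleftrightarrow> a \<notin> S"

fun fo_body_literal ::
  "'c set \<Rightarrow> ('p, 'c, 'v) atom set \<Rightarrow> ('p, 'c, 'v) body_literal \<Rightarrow> bool" where
  "fo_body_literal U S (Lit l) \<longleftrightarrow> fo_literal S l"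
| "fo_body_literal U S (Gen Y a b) \<longleftrightarrow>
     (\<forall>\<tau>. range \<tau> \<subseteq> U \<longrightarrow> subst_atom (set Y) \<tau> a \<in> S \<longrightarrow> subst_atom (set Y) \<tau> b \<in> S)"

text \<open>Satisfaction over the domain \<open>U\<close> of the universally quantified clauses that
  correspond to the rules of \<open>P\<close>: the quantifiers range over the groundings.\<close>

definition fo_model ::
  "'c set \<Rightarrow> ('p, 'c, 'v) atom set \<Rightarrow> ('p, 'c, 'v) program \<Rightarrow> bool" where
  "fo_model U S P \<longleftrightarrow>
     (\<forall>r \<in> grounding P U.
        (\<forall>l \<in> body r. fo_body_literal U S l) \<longrightarrow> (\<exists>l \<in> head r. fo_literal S l))"

definition models_over ::
  "('p \<Rightarrow> nat) \<Rightarrow> 'c set \<Rightarrow> ('p, 'c, 'v) program \<Rightarrow> ('p, 'c, 'v) atom set \<Rightarrow>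
     ('p, 'c, 'v) atom set set" where
  "models_over ar U P V =
     {S. is_structure ar (preds P) U S \<and> fo_model U S P \<and>
         restrict S (edb P) = restrict V (edb P)}"

definition minimal_model ::
  "('p \<Rightarrow> nat) \<Rightarrow> 'c set \<Rightarrow> ('p, 'c, 'v) program \<Rightarrow> ('p, 'c, 'v) atom set \<Rightarrow>
     ('p, 'c, 'v) atom set" where
  "minimal_model ar U P V =
     (THE S. S \<in> models_over ar U P V \<and> (\<forall>T \<in> models_over ar U P V. \<not> T \<subset> S))"

definition lfp_model ::
  "('p \<Rightarrow> nat) \<Rightarrow> 'c set \<Rightarrow> ('p, 'c, 'v) program list \<Rightarrow> ('p, 'c, 'v) atom set \<Rightarrow>
     ('p, 'c, 'v) atom set" where
  "lfp_model ar U Ps V = foldl (\<lambda>W Q. W \<union> minimal_model ar U Q W) V Ps"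

end

theory Submission
  imports Defs
begin

text \<open>The proof goes by induction on the strata. Let \<open>M\<^sub>0\<close> be the unique open answer
  set of the lower strata. The predicates defined by the top stratum \<open>Q\<close> do not occur below,
  so every open answer set of the whole program agrees with \<open>M\<^sub>0\<close> outside them; and the
  negative literals and antecedents in \<open>Q\<close> are evaluated in \<open>M\<^sub>0\<close>. Hence the reduct of \<open>Q\<close>
  is one fixed definite program, whose models above \<open>M\<^sub>0\<close> are closed under intersection. The
  least of them is the only open answer set, and its part over the predicates of \<open>Q\<close> is the
  minimal first-order model of \<open>Q\<close> with input \<open>M\<^sub>0\<close>.\<close>

section \<open>Closure under the reduct\<close>

text \<open>Two interpretations separate what the reduct fixes from what a candidate model decides:
  \<open>M\<close> evaluates naf-literals and antecedents, \<open>J\<close> evaluates positive atoms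
  and consequents. For fixed \<open>M\<close> the condition is therefore monotone in
  \<open>J\<close>.\<close>

fun reduct_sat :: "'c set \<Rightarrow> ('p, 'c, 'v) atom set \<Rightarrow> ('p, 'c, 'v) atom set \<Rightarrow>
    ('p, 'c, 'v) body_literal \<Rightarrow> bool" where
  "reduct_sat U M J (Lit (Pos a)) \<longleftrightarrow> sat_atom J a"
| "reduct_sat U M J (Lit (Naf a)) \<longleftrightarrow> \<not> sat_atom M a"
| "reduct_sat U M J (Gen Y a b) \<longleftrightarrow>
     (\<forall>\<tau>. range \<tau> \<subseteq> U \<longrightarrow> sat_atom M (subst_atom (set Y) \<tau> a) \<longrightarrow>
       sat_atom J (subst_atom (set Y) \<tau> b))"

text \<open>\<open>J\<close> is a model of the reduct of \<open>P\<close> with respect to \<open>M\<close>.\<close>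

definition reduct_closed :: "'c set \<Rightarrow> ('p, 'c, 'v) program \<Rightarrow> ('p, 'c, 'v) atom set \<Rightarrow>
    ('p, 'c, 'v) atom set \<Rightarrow> bool" where
  "reduct_closed U P M J \<longleftrightarrow>
     (\<forall>r\<in>P. \<forall>\<sigma> h. range \<sigma> \<subseteq> U \<longrightarrow>
        (\<forall>l\<in>body r. reduct_sat U M J (ground_body_literal \<sigma> l)) \<longrightarrow>
        Pos h \<in> head r \<longrightarrow> sat_atom J (subst_atom UNIV \<sigma> h))"

lemma reduct_closedD:
  assumes "reduct_closed U P M J" "r \<in> P" "range \<sigma> \<subseteq> U" "Pos h \<in> head r"
    "\<And>l. l \<in> body r \<Longrightarrow> reduct_sat U M J (ground_body_literal \<sigma> l)"
  shows "sat_atom J (subst_atom UNIV \<sigma> h)"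
  using assms unfolding reduct_closed_def by blast

lemma reduct_closed_Un:
  "reduct_closed U (P \<union> Q) M J \<longleftrightarrow> reduct_closed U P M J \<and> reduct_closed U Q M J"
  unfolding reduct_closed_def by blast

text \<open>\<open>\<beta>'\<close> is the body after the GeLi-reduct. A generalized literal
  contributes exactly the consequents whose antecedents hold in \<open>M\<close>; that all of them
  hold in \<open>J\<close> is the quantified implication in \<open>reduct_sat\<close>.\<close>

lemma reduct_body_iff:
  fixes \<beta> :: "('p, 'c, 'v) body_literal set"
    and U :: "'c set" and M :: "('p, 'c, 'v) atom set"
  defines "\<beta>' \<equiv> (\<beta> \<inter> range Lit) \<union>
     {Lit (Pos (subst_atom (set Y) \<tau> b)) | Y a b \<tau>.
        Gen Y a b \<in> \<beta> \<and> range \<tau> \<subseteq> U \<and> sat_atom M (subst_atom (set Y) \<tau> a)}"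
  shows "(\<forall>a. Lit (Naf a) \<in> \<beta>' \<longrightarrow> \<not> sat_atom M a) \<and> (\<forall>a. Lit (Pos a) \<in> \<beta>' \<longrightarrow> sat_atom J a)
    \<longleftrightarrow> (\<forall>l\<in>\<beta>. reduct_sat U M J l)" (is "?L \<longleftrightarrow> ?R")
proof
  assume L: ?L
  show ?R
  proof
    fix l assume l: "l \<in> \<beta>"
    show "reduct_sat U M J l"
    proof (cases l)
      case (Lit k)
      then show ?thesis using L l by (cases k) (auto simp: \<beta>'_def)
    next
      case (Gen Y a b)
      have "Lit (Pos (subst_atom (set Y) \<tau> b)) \<in> \<beta>'"
        if "range \<tau> \<subseteq> U" "sat_atom M (subst_atom (set Y) \<tau> a)" for \<tau>
        unfolding \<beta>'_def using that l Gen by blast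
      then show ?thesis using L Gen by auto
    qed
  qed
next
  assume R: ?R
  show ?L
  proof (intro conjI allI impI)
    fix a assume "Lit (Naf a) \<in> \<beta>'"
    then have "Lit (Naf a) \<in> \<beta>" by (auto simp: \<beta>'_def)
    then show "\<not> sat_atom M a" using R by force
  next
    fix a assume "Lit (Pos a) \<in> \<beta>'"
    then consider "Lit (Pos a) \<in> \<beta>"
      | Y a' b \<tau> where "Gen Y a' b \<in> \<beta>" "range \<tau> \<subseteq> U" "sat_atom M (subst_atom (set Y) \<tau> a')"
          "a = subst_atom (set Y) \<tau> b"
      by (auto simp: \<beta>'_def)
    then show "sat_atom J a"
    proof cases
      case 1
      then show ?thesis using R by force
    next
      case 2
      from R 2(1) have "reduct_sat U M J (Gen Y a' b)" by blast
      with 2 show ?thesis by simp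
    qed
  qed
qed

text \<open>Collapses both reducts into one closure condition. This works because a Datalog head is
  a single positive atom, which makes the disjunction over the head trivial and the condition on
  naf-atoms in the head vacuous.\<close>

lemma positive_model_reduct_iff:
  fixes P :: "('p, 'c, 'v) program"
  assumes "\<forall>r\<in>P. datalog_rule r"
  shows "positive_model J (gl_reduct (geli_reduct (grounding P U) U M) M)
    \<longleftrightarrow> reduct_closed U P M J"
proof -
  \<comment> \<open>\<open>B r\<close> is the body after the GeLi-reduct; \<open>N r\<close> says
    that its naf-literals let the rule survive the reduct at \<open>M\<close>, and
    \<open>A r\<close> that its positive atoms hold in \<open>J\<close>.\<close>
  define B where "B r = (body r \<inter> range Lit) \<union>
     {Lit (Pos (subst_atom (set Y) \<tau> b)) | Y a b \<tau>.
        Gen Y a b \<in> body r \<and> range \<tau> \<subseteq> U \<and> sat_atom M (subst_atom (set Y) \<tau> a)}"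
    for r :: "('p, 'c, 'v) rule"
  define N where "N r \<longleftrightarrow> (\<forall>a. Lit (Naf a) \<in> B r \<longrightarrow> \<not> sat_atom M a)" for r
  define A where "A r \<longleftrightarrow> (\<forall>a. Lit (Pos a) \<in> B r \<longrightarrow> sat_atom J a)" for r
  have head: "\<exists>q ts. head (ground_rule \<sigma> r) = {Pos (subst_atom UNIV \<sigma> (Rel q ts))} \<and>
      head r = {Pos (Rel q ts)}" if "r \<in> P" for r \<sigma>
    using assms that unfolding datalog_rule_def ground_rule_def by fastforce
  have NA: "N r \<and> A r \<longleftrightarrow> (\<forall>l\<in>body r. reduct_sat U M J l)" for r
    unfolding N_def A_def B_def by (rule reduct_body_iff)
  \<comment> \<open>Written as an image, the reduct lets quantification over its pairs become
    quantification over rules.\<close>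
  have gl: "gl_reduct R M = (\<lambda>r. ({a. Pos a \<in> head r}, {a. Lit (Pos a) \<in> body r})) `
      {r\<in>R. (\<forall>a. Lit (Naf a) \<in> body r \<longrightarrow> \<not> sat_atom M a) \<and>
        (\<forall>a. Naf a \<in> head r \<longrightarrow> sat_atom M a)}" for R :: "('p, 'c, 'v) program"
    unfolding gl_reduct_def by blast
  have "positive_model J (gl_reduct (geli_reduct (grounding P U) U M) M) \<longleftrightarrow>
    (\<forall>r\<in>geli_reduct (grounding P U) U M.
        (\<forall>a. Lit (Naf a) \<in> body r \<longrightarrow> \<not> sat_atom M a) \<longrightarrow>
        (\<forall>a. Naf a \<in> head r \<longrightarrow> sat_atom M a) \<longrightarrow>
        (\<forall>a. Lit (Pos a) \<in> body r \<longrightarrow> sat_atom J a) \<longrightarrow> (\<exists>a. Pos a \<in> head r \<and> sat_atom J a))"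
    unfolding positive_model_def gl by auto
  also have "\<dots> \<longleftrightarrow> (\<forall>r\<in>grounding P U. N r \<longrightarrow> (\<forall>a. Naf a \<in> head r \<longrightarrow> sat_atom M a) \<longrightarrow>
        A r \<longrightarrow> (\<exists>a. Pos a \<in> head r \<and> sat_atom J a))"
    unfolding geli_reduct_def N_def A_def B_def by simp
  also have "\<dots> \<longleftrightarrow> (\<forall>r\<in>P. \<forall>\<sigma>. range \<sigma> \<subseteq> U \<longrightarrow> N (ground_rule \<sigma> r) \<longrightarrow>
        (\<forall>a. Naf a \<in> head (ground_rule \<sigma> r) \<longrightarrow> sat_atom M a) \<longrightarrow>
        A (ground_rule \<sigma> r) \<longrightarrow> (\<exists>a. Pos a \<in> head (ground_rule \<sigma> r) \<and> sat_atom J a))"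
    unfolding grounding_def by blast
  also have "\<dots> \<longleftrightarrow> (\<forall>r\<in>P. \<forall>\<sigma>. range \<sigma> \<subseteq> U \<longrightarrow>
        N (ground_rule \<sigma> r) \<and> A (ground_rule \<sigma> r) \<longrightarrow>
        (\<forall>h. Pos h \<in> head r \<longrightarrow> sat_atom J (subst_atom UNIV \<sigma> h)))"
  proof (intro ball_cong refl all_cong1)
    fix r \<sigma> assume "r \<in> P"
    from head[OF this] obtain q ts where
      "head (ground_rule \<sigma> r) = {Pos (subst_atom UNIV \<sigma> (Rel q ts))}" "head r = {Pos (Rel q ts)}"
      by blast
    then show "(range \<sigma> \<subseteq> U \<longrightarrow> N (ground_rule \<sigma> r) \<longrightarrow>
        (\<forall>a. Naf a \<in> head (ground_rule \<sigma> r) \<longrightarrow> sat_atom M a) \<longrightarrow>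
        A (ground_rule \<sigma> r) \<longrightarrow> (\<exists>a. Pos a \<in> head (ground_rule \<sigma> r) \<and> sat_atom J a)) \<longleftrightarrow>
      (range \<sigma> \<subseteq> U \<longrightarrow> N (ground_rule \<sigma> r) \<and> A (ground_rule \<sigma> r) \<longrightarrow>
        (\<forall>h. Pos h \<in> head r \<longrightarrow> sat_atom J (subst_atom UNIV \<sigma> h)))"
      by auto
  qed
  also have "\<dots> \<longleftrightarrow> reduct_closed U P M J"
    unfolding NA reduct_closed_def by (simp add: ground_rule_def)
  finally show ?thesis .
qed

lemma open_answer_set_iff:
  assumes "\<forall>r\<in>P. datalog_rule r"
  shows "open_answer_set ar P U M \<longleftrightarrow>
    universe P U \<and> M \<subseteq> ground_regular ar (preds P) U \<and> reduct_closed U P M M \<and>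
    (\<forall>J. J \<subset> M \<longrightarrow> \<not> reduct_closed U P M J)"
  unfolding open_answer_set_def answer_set_def positive_model_reduct_iff[OF assms] by simp

section \<open>Unions of programs\<close>

lemma head_atoms_Un: "head_atoms (P \<union> Q) = head_atoms P \<union> head_atoms Q"
  by (auto simp: head_atoms_def)

lemma body_atoms_Un: "body_atoms (P \<union> Q) = body_atoms P \<union> body_atoms Q"
  by (auto simp: body_atoms_def)

lemma head_preds_Un: "head_preds (P \<union> Q) = head_preds P \<union> head_preds Q"
  by (simp add: head_preds_def head_atoms_Un image_Un)

lemma preds_Un: "preds (P \<union> Q) = preds P \<union> preds Q"
  by (auto simp: preds_def body_preds_def head_preds_Un body_atoms_Un)

lemma constants_Un: "constants (P \<union> Q) = constants P \<union> constants Q"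
  by (auto simp: constants_def head_atoms_Un body_atoms_Un)

lemma respects_arity_Un:
  "respects_arity ar (P \<union> Q) \<longleftrightarrow> respects_arity ar P \<and> respects_arity ar Q"
  by (auto simp: respects_arity_def head_atoms_Un body_atoms_Un)

section \<open>Dependence on predicates\<close>

lemma pred_of_subst [simp]: "pred_of (subst_atom V \<sigma> a) = pred_of a"
  by (cases a) auto

lemma pred_of_ground_regular: "a \<in> ground_regular ar \<Pi> U \<Longrightarrow> pred_of a \<in> \<Pi>"
  by (auto simp: ground_regular_def)

lemma regular_ground_regular: "a \<in> ground_regular ar \<Pi> U \<Longrightarrow> pred_of a \<noteq> Equality"
  by (auto simp: ground_regular_def)

lemma ground_regular_mono:
  "\<Pi> \<subseteq> \<Pi>' \<Longrightarrow> ground_regular ar \<Pi> U \<subseteq> ground_regular ar \<Pi>' U"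
  by (auto simp: ground_regular_def)

section \<open>Which atoms the reduct and its models depend on\<close>

definition agree :: "'p predicate set \<Rightarrow> ('p, 'c, 'v) atom set \<Rightarrow> ('p, 'c, 'v) atom set \<Rightarrow> bool"
  where "agree \<Pi> I J \<longleftrightarrow> (\<forall>a. pred_of a \<in> \<Pi> \<longrightarrow> (a \<in> I \<longleftrightarrow> a \<in> J))"

lemma agree_sat:
  assumes "agree \<Pi> I J" "pred_of a \<in> \<Pi>"
  shows "sat_atom I a \<longleftrightarrow> sat_atom J a"
  using assms by (cases a) (auto simp: agree_def)

lemma sat_atom_mono: "I \<subseteq> J \<Longrightarrow> sat_atom I a \<Longrightarrow> sat_atom J a"
  by (cases a) auto

lemma reduct_sat_mono: "I \<subseteq> J \<Longrightarrow> reduct_sat U M I l \<Longrightarrow> reduct_sat U M J l"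
  by (induction U M I l rule: reduct_sat.induct) (auto dest: sat_atom_mono)

text \<open>The predicates at the places where the reduct consults \<open>M\<close> instead of
  \<open>J\<close>.\<close>

definition nonmonotone_preds :: "('p, 'c, 'v) program \<Rightarrow> 'p predicate set" where
  "nonmonotone_preds P = {pred_of a | a. \<exists>r\<in>P. Lit (Naf a) \<in> body r \<or> (\<exists>Y b. Gen Y a b \<in> body r)}"

lemma nonmonotone_preds_subset: "nonmonotone_preds P \<subseteq> preds P"
proof
  fix q assume "q \<in> nonmonotone_preds P"
  then obtain a r l where "q = pred_of a" "r \<in> P" "l \<in> body r" "a \<in> body_literal_atoms l"
    unfolding nonmonotone_preds_def by fastforce
  then show "q \<in> preds P"
    unfolding preds_def body_preds_def body_atoms_def by blast
qed

lemma basic_datalog_nonmonotone: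
  "basic_datalog P \<Longrightarrow> nonmonotone_preds P \<inter> head_preds P = {}"
  unfolding basic_datalog_def nonmonotone_preds_def by blast

lemma body_atom_pred:
  "r \<in> P \<Longrightarrow> l \<in> body r \<Longrightarrow> a \<in> body_literal_atoms l \<Longrightarrow> pred_of a \<in> preds P"
  unfolding preds_def body_preds_def body_atoms_def by blast

lemma head_atom_pred: "r \<in> P \<Longrightarrow> Pos h \<in> head r \<Longrightarrow> pred_of h \<in> head_preds P"
  unfolding head_preds_def head_atoms_def by force

lemma reduct_sat_cong:
  assumes "agree (preds P) J J'" "agree (nonmonotone_preds P) M M'" "r \<in> P" "l \<in> body r"
  shows "reduct_sat U M J (ground_body_literal \<sigma> l) \<longleftrightarrow>
    reduct_sat U M' J' (ground_body_literal \<sigma> l)"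
proof (cases l)
  case (Lit k)
  show ?thesis
  proof (cases k)
    case (Pos a)
    have "pred_of a \<in> preds P" using body_atom_pred[OF assms(3,4)] Lit Pos by simp
    then show ?thesis using Lit Pos agree_sat[OF assms(1)] by simp
  next
    case (Naf a)
    have "pred_of a \<in> nonmonotone_preds P"
      unfolding nonmonotone_preds_def using assms(3,4) Lit Naf by blast
    then show ?thesis using Lit Naf agree_sat[OF assms(2)] by simp
  qed
next
  case (Gen Y a b)
  have "pred_of b \<in> preds P" using body_atom_pred[OF assms(3,4)] Gen by simp
  moreover have "pred_of a \<in> nonmonotone_preds P"
    unfolding nonmonotone_preds_def using assms(3,4) Gen by blast
  ultimately show ?thesis using Gen agree_sat[OF assms(1)] agree_sat[OF assms(2)] by simp
qed

text \<open>\<open>J\<close> is consulted at heads, positive atoms and consequents, \<open>M\<close>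
  only at naf-literals and antecedents; hence the different predicate sets in the two
  assumptions.\<close>

lemma reduct_closed_cong:
  assumes "agree (preds P) J J'" "agree (nonmonotone_preds P) M M'"
  shows "reduct_closed U P M J \<longleftrightarrow> reduct_closed U P M' J'"
proof -
  have head: "sat_atom J (subst_atom UNIV \<sigma> h) \<longleftrightarrow> sat_atom J' (subst_atom UNIV \<sigma> h)"
    if "r \<in> P" "Pos h \<in> head r" for r \<sigma> h
    using agree_sat[OF assms(1)] head_atom_pred[OF that] by (simp add: preds_def)
  have body: "(\<forall>l\<in>body r. reduct_sat U M J (ground_body_literal \<sigma> l)) \<longleftrightarrow>
      (\<forall>l\<in>body r. reduct_sat U M' J' (ground_body_literal \<sigma> l))" if "r \<in> P" for r \<sigma>
    using reduct_sat_cong[OF assms that] by (intro ball_cong refl)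
  show ?thesis
    unfolding reduct_closed_def
    by (intro ball_cong refl) (simp add: body head cong: imp_cong)
qed

text \<open>The reduct is a definite program: a body true in the intersection is true in every
  member, so each member contains the head, which is a single regular atom.\<close>

lemma reduct_closed_Inter:
  assumes P: "\<forall>r\<in>P. datalog_rule r" and F: "\<And>J. J \<in> F \<Longrightarrow> reduct_closed U P M J"
  shows "reduct_closed U P M (\<Inter>F)"
  unfolding reduct_closed_def
proof (intro ballI allI impI)
  fix r \<sigma> h
  assume r: "r \<in> P" "range \<sigma> \<subseteq> U" "Pos h \<in> head r"
    and b: "\<forall>l\<in>body r. reduct_sat U M (\<Inter>F) (ground_body_literal \<sigma> l)"
  obtain q ts where h: "h = Rel q ts"
    using P r unfolding datalog_rule_def by fastforce
  have "sat_atom J (subst_atom UNIV \<sigma> h)" if "J \<in> F" for J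
    using F[OF that] r by (rule reduct_closedD) (use b that reduct_sat_mono in blast)
  then show "sat_atom (\<Inter>F) (subst_atom UNIV \<sigma> h)"
    using h by auto
qed

section \<open>Ground heads\<close>

text \<open>Collects what makes every ground head a well-formed regular atom over
  \<open>U\<close>.\<close>

definition safe :: "('p \<Rightarrow> nat) \<Rightarrow> 'c set \<Rightarrow> ('p, 'c, 'v) program \<Rightarrow> bool" where
  "safe ar U P \<longleftrightarrow> respects_arity ar P \<and> constants P \<subseteq> U \<and> (\<forall>r\<in>P. datalog_rule r)"

lemma subst_trm_UNIV:
  "range \<sigma> \<subseteq> U \<Longrightarrow> (\<And>c. t = Const c \<Longrightarrow> c \<in> U) \<Longrightarrow> subst_trm UNIV \<sigma> t \<in> Const ` U"
  by (cases t) auto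

lemma ground_head:
  assumes P: "safe ar U P" and r: "r \<in> P" "Pos h \<in> head r" and \<sigma>: "range \<sigma> \<subseteq> U"
  shows "subst_atom UNIV \<sigma> h \<in> ground_regular ar (head_preds P) U"
proof -
  obtain q ts where h: "h = Rel q ts"
    using P r unfolding datalog_rule_def safe_def by fastforce
  have in_head: "Rel q ts \<in> head_atoms P"
    unfolding head_atoms_def using r h by force
  then have len: "length ts = ar q"
    using P unfolding safe_def respects_arity_def by blast
  have const: "c \<in> U" if "Const c \<in> set ts" for c
  proof -
    have "c \<in> constants P"
      unfolding constants_def using in_head that by force
    then show ?thesis using P by (auto simp: safe_def)
  qed
  have "set (map (subst_trm UNIV \<sigma>) ts) \<subseteq> Const ` U"
  proof
    fix t assume "t \<in> set (map (subst_trm UNIV \<sigma>) ts)"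
    then obtain s where "s \<in> set ts" "t = subst_trm UNIV \<sigma> s" by auto
    then show "t \<in> Const ` U"
      using subst_trm_UNIV[OF \<sigma>, of s] const by blast
  qed
  moreover have "Pred q \<in> head_preds P"
    using head_atom_pred[OF r] h by simp
  ultimately show ?thesis
    using h len by (simp add: ground_regular_def)
qed

text \<open>Shrinking a model makes fewer bodies true, and the heads that still have to hold are
  ground instances of head predicates, which \<open>A\<close> retains. This is the means of
  discarding underivable atoms.\<close>

lemma reduct_closed_restrict:
  assumes P: "safe ar U P" and J: "reduct_closed U P M J"
    and sub: "ground_regular ar (head_preds P) U \<subseteq> A"
  shows "reduct_closed U P M (J \<inter> A)"
  unfolding reduct_closed_def
proof (intro ballI allI impI)
  fix r \<sigma> h
  assume r: "r \<in> P" "range \<sigma> \<subseteq> U" "Pos h \<in> head r"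
    and b: "\<forall>l\<in>body r. reduct_sat U M (J \<inter> A) (ground_body_literal \<sigma> l)"
  have "sat_atom J (subst_atom UNIV \<sigma> h)"
    using J r by (rule reduct_closedD) (use b reduct_sat_mono[of "J \<inter> A" J] in blast)
  moreover have "subst_atom UNIV \<sigma> h \<in> ground_regular ar (head_preds P) U"
    using ground_head[OF P r(1,3,2)] .
  ultimately show "sat_atom (J \<inter> A) (subst_atom UNIV \<sigma> h)"
    using sub by (cases h) (auto simp: ground_regular_def)
qed

text \<open>Atoms over other predicates could be deleted without destroying closure, against
  minimality.\<close>

lemma open_answer_set_heads:
  assumes P: "safe ar U P" and M: "open_answer_set ar P U M"
  shows "M \<subseteq> ground_regular ar (head_preds P) U"
proof -
  have dr: "\<forall>r\<in>P. datalog_rule r" using P by (simp add: safe_def)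
  let ?J = "M \<inter> ground_regular ar (head_preds P) U"
  have "reduct_closed U P M ?J"
    using M open_answer_set_iff[OF dr] by (intro reduct_closed_restrict[OF P]) auto
  then have "\<not> ?J \<subset> M"
    using M open_answer_set_iff[OF dr] by blast
  then show ?thesis by blast
qed

section \<open>First-order models\<close>

text \<open>Grounding the free variables first and the bound ones afterwards is one total grounding,
  so facts about total groundings apply inside generalized literals.\<close>

lemma subst_subst_atom:
  "subst_atom V \<tau> (subst_atom (- V) \<sigma> a) = subst_atom UNIV (\<lambda>x. if x \<in> V then \<tau> x else \<sigma> x) a"
proof -
  have "subst_trm V \<tau> (subst_trm (- V) \<sigma> t) = subst_trm UNIV (\<lambda>x. if x \<in> V then \<tau> x else \<sigma> x) t"
    for t by (cases t) auto
  then show ?thesis by (cases a) auto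
qed

text \<open>Structures store equality atoms as members, whereas \<open>sat_atom\<close> compares the
  terms. The two readings coincide once the ground terms lie in \<open>U\<close>, which is why the
  constants are constrained.\<close>

lemma mem_structure_iff:
  assumes "\<forall>a\<in>J. pred_of a \<noteq> Equality" "range \<sigma> \<subseteq> U" "\<And>c. Const c \<in> atom_terms a \<Longrightarrow> c \<in> U"
  shows "subst_atom UNIV \<sigma> a \<in> id_structure U \<union> J \<longleftrightarrow> sat_atom J (subst_atom UNIV \<sigma> a)"
proof (cases a)
  case (Rel q ts)
  then show ?thesis by (auto simp: id_structure_def)
next
  case (Eq t s)
  have "subst_trm UNIV \<sigma> t \<in> Const ` U"
    using Eq assms(3) by (intro subst_trm_UNIV[OF assms(2)]) auto
  then show ?thesis using Eq assms(1) by (auto simp: id_structure_def)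
qed

lemma fo_body_literal_iff:
  assumes J: "\<forall>a\<in>J. pred_of a \<noteq> Equality" and \<sigma>: "range \<sigma> \<subseteq> U"
    and c: "\<And>a c. a \<in> body_literal_atoms l \<Longrightarrow> Const c \<in> atom_terms a \<Longrightarrow> c \<in> U"
  shows "fo_body_literal U (id_structure U \<union> J) (ground_body_literal \<sigma> l) \<longleftrightarrow>
    reduct_sat U J J (ground_body_literal \<sigma> l)"
proof (cases l)
  case (Lit k)
  have "subst_atom UNIV \<sigma> (literal_atom k) \<in> id_structure U \<union> J \<longleftrightarrow>
      sat_atom J (subst_atom UNIV \<sigma> (literal_atom k))"
    using Lit c by (intro mem_structure_iff[OF J \<sigma>]) auto
  then show ?thesis using Lit by (cases k) auto
next
  case (Gen Y a b)
  have "subst_atom UNIV (\<lambda>x. if x \<in> set Y then \<tau> x else \<sigma> x) d \<in> id_structure U \<union> J \<longleftrightarrow>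
      sat_atom J (subst_atom UNIV (\<lambda>x. if x \<in> set Y then \<tau> x else \<sigma> x) d)"
    if "range \<tau> \<subseteq> U" "d \<in> {a, b}" for \<tau> d
    using Gen c that \<sigma> by (intro mem_structure_iff[OF J]) auto
  then show ?thesis using Gen by (simp add: subst_subst_atom)
qed

text \<open>First-order negation and antecedents are evaluated in the structure itself, so the
  corresponding reduct is the one taken at \<open>J\<close>.\<close>

lemma fo_model_iff:
  assumes P: "safe ar U P" and J: "\<forall>a\<in>J. pred_of a \<noteq> Equality"
  shows "fo_model U (id_structure U \<union> J) P \<longleftrightarrow> reduct_closed U P J J"
proof -
  have body: "(\<forall>l\<in>body (ground_rule \<sigma> r). fo_body_literal U (id_structure U \<union> J) l) \<longleftrightarrow>
      (\<forall>l\<in>body r. reduct_sat U J J (ground_body_literal \<sigma> l))"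
    if "r \<in> P" "range \<sigma> \<subseteq> U" for r \<sigma>
  proof -
    have "c \<in> U" if "l \<in> body r" "a \<in> body_literal_atoms l" "Const c \<in> atom_terms a" for l a c
    proof -
      have "c \<in> constants P"
        unfolding constants_def body_atoms_def using that \<open>r \<in> P\<close> by blast
      then show ?thesis using P by (auto simp: safe_def)
    qed
    then have "fo_body_literal U (id_structure U \<union> J) (ground_body_literal \<sigma> l) \<longleftrightarrow>
        reduct_sat U J J (ground_body_literal \<sigma> l)" if "l \<in> body r" for l
      using that by (intro fo_body_literal_iff[OF J \<open>range \<sigma> \<subseteq> U\<close>]) blast
    then show ?thesis by (simp add: ground_rule_def)
  qed
  \<comment> \<open>The only head atom is regular, so it cannot lie in
    \<open>id_structure U\<close>.\<close>
  have head: "(\<exists>l\<in>head (ground_rule \<sigma> r). fo_literal (id_structure U \<union> J) l) \<longleftrightarrow>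
      (\<forall>h. Pos h \<in> head r \<longrightarrow> sat_atom J (subst_atom UNIV \<sigma> h))" if "r \<in> P" for r \<sigma>
  proof -
    have "datalog_rule r" using P that by (simp add: safe_def)
    then obtain q ts where "head r = {Pos (Rel q ts)}"
      unfolding datalog_rule_def by blast
    then show ?thesis by (auto simp: ground_rule_def id_structure_def)
  qed
  have "fo_model U (id_structure U \<union> J) P \<longleftrightarrow> (\<forall>r\<in>P. \<forall>\<sigma>. range \<sigma> \<subseteq> U \<longrightarrow>
      (\<forall>l\<in>body (ground_rule \<sigma> r). fo_body_literal U (id_structure U \<union> J) l) \<longrightarrow>
      (\<exists>l\<in>head (ground_rule \<sigma> r). fo_literal (id_structure U \<union> J) l))"
    unfolding fo_model_def grounding_def by blast
  also have "\<dots> \<longleftrightarrow> reduct_closed U P J J"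
    unfolding reduct_closed_def by (intro ball_cong refl) (simp add: body head cong: imp_cong)
  finally show ?thesis .
qed

text \<open>A least element is the only minimal one, which settles the definite description.\<close>

lemma minimal_model_eqI:
  assumes "T \<in> models_over ar U P V" "\<And>S. S \<in> models_over ar U P V \<Longrightarrow> T \<subseteq> S"
  shows "minimal_model ar U P V = T"
  unfolding minimal_model_def
proof (rule the_equality)
  show "T \<in> models_over ar U P V \<and> (\<forall>S\<in>models_over ar U P V. \<not> S \<subset> T)"
    using assms by (simp add: leD)
next
  fix S assume S: "S \<in> models_over ar U P V \<and> (\<forall>S'\<in>models_over ar U P V. \<not> S' \<subset> S)"
  then have "T \<subseteq> S" "\<not> T \<subset> S" using assms by simp_all
  then show "S = T" by (simp add: psubset_eq)
qed

section \<open>Adding a stratum\<close>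

text \<open>The induction step in isolation: \<open>P\<close> stands for the union of the strata
  below \<open>Q\<close>. Uniqueness of \<open>M\<^sub>0\<close> is supplied separately in
  \<open>open_answer_set_unique\<close>.\<close>

locale top_stratum =
  fixes ar :: "'p \<Rightarrow> nat" and U :: "'c set" and P Q :: "('p, 'c, 'v) program"
    and M\<^sub>0 :: "('p, 'c, 'v) atom set"
  assumes univ: "universe (P \<union> Q) U" and safe: "safe ar U P" "safe ar U Q"
    and basic: "basic_datalog Q"
    and disjoint: "head_preds Q \<inter> preds P = {}"
    and lower: "open_answer_set ar P U M\<^sub>0"
begin

section \<open>The least model of the top stratum above \<open>M\<^sub>0\<close>\<close>

abbreviation "heads \<equiv> ground_regular ar (head_preds Q) U :: ('p, 'c, 'v) atom set"

text \<open>Taking the reduct at \<open>M\<^sub>0\<close> for every \<open>J\<close> yields a single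
  definite program; the inclusion adds the atoms of \<open>M\<^sub>0\<close> as facts.\<close>

definition models :: "('p, 'c, 'v) atom set set" where
  "models = {J. M\<^sub>0 \<subseteq> J \<and> reduct_closed U Q M\<^sub>0 J}"

definition least :: "('p, 'c, 'v) atom set" where
  "least = \<Inter> models"

lemma datalog: "\<forall>r\<in>P. datalog_rule r" "\<forall>r\<in>Q. datalog_rule r" "\<forall>r\<in>P \<union> Q. datalog_rule r"
  using safe by (auto simp: safe_def)

lemma universe_lower: "universe P U"
  using lower by (simp add: open_answer_set_def)

lemma lower_heads: "M\<^sub>0 \<subseteq> ground_regular ar (head_preds P) U"
  by (rule open_answer_set_heads[OF safe(1) lower])

lemma lower_pred: "a \<in> M\<^sub>0 \<Longrightarrow> pred_of a \<notin> head_preds Q"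
  using lower_heads pred_of_ground_regular disjoint by (fastforce simp: preds_def)

lemma preds_edb: "preds Q \<subseteq> head_preds Q \<union> edb Q"
  unfolding preds_def edb_def by blast

lemma least_in_models: "least \<in> models"
  using reduct_closed_Inter[OF datalog(2), of models] by (auto simp: least_def models_def)

text \<open>Cutting \<open>least\<close> down to the right-hand side leaves a member of
  \<open>models\<close>, so the intersection is no larger.\<close>

lemma least_subset: "least \<subseteq> M\<^sub>0 \<union> heads"
proof -
  have "reduct_closed U Q M\<^sub>0 (least \<inter> (M\<^sub>0 \<union> heads))"
    using least_in_models by (intro reduct_closed_restrict[OF safe(2)]) (auto simp: models_def)
  then have "least \<inter> (M\<^sub>0 \<union> heads) \<in> models"
    using least_in_models by (auto simp: models_def)
  then show ?thesis unfolding least_def by blast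
qed

lemma lower_subset_least: "M\<^sub>0 \<subseteq> least"
  using least_in_models by (simp add: models_def)

lemma agree_least: "agree (- head_preds Q) least M\<^sub>0"
  using least_subset lower_subset_least pred_of_ground_regular unfolding agree_def by blast

section \<open>Stratification as invariance of the reducts\<close>

lemma agree_mono: "agree \<Pi> I J \<Longrightarrow> \<Pi>' \<subseteq> \<Pi> \<Longrightarrow> agree \<Pi>' I J"
  unfolding agree_def by blast

text \<open>No head predicate of \<open>Q\<close> occurs in \<open>P\<close>, so \<open>P\<close>
  cannot detect a change in their atoms.\<close>

lemma reduct_closed_lower_cong:
  assumes "agree (- head_preds Q) J J'" "agree (- head_preds Q) M M'"
  shows "reduct_closed U P M J \<longleftrightarrow> reduct_closed U P M' J'"
  using assms disjoint nonmonotone_preds_subset[of P]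
  by (intro reduct_closed_cong) (blast intro: agree_mono)+

text \<open>In a basic program the naf-literals and antecedents avoid its own head predicates;
  guessing those heads differently leaves the reduct of \<open>Q\<close> unchanged.\<close>

lemma reduct_closed_top_cong:
  assumes "agree (- head_preds Q) M M'"
  shows "reduct_closed U Q M J \<longleftrightarrow> reduct_closed U Q M' J"
proof (rule reduct_closed_cong)
  show "agree (preds Q) J J" by (simp add: agree_def)
  show "agree (nonmonotone_preds Q) M M'"
    using basic_datalog_nonmonotone[OF basic] by (intro agree_mono[OF assms]) blast
qed

text \<open>For minimality, strip a smaller model \<open>J\<close> of the head predicates of
  \<open>Q\<close>. What remains is a model of the lower reduct inside \<open>M\<^sub>0\<close>,
  hence all of \<open>M\<^sub>0\<close>; so \<open>J\<close> belongs to \<open>models\<close> and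
  contains \<open>least\<close>.\<close>

lemma open_answer_set_least: "open_answer_set ar (P \<union> Q) U least"
  unfolding open_answer_set_iff[OF datalog(3)]
proof (intro conjI allI impI univ)
  have low: "M\<^sub>0 \<subseteq> ground_regular ar (preds P) U" "reduct_closed U P M\<^sub>0 M\<^sub>0"
    "\<And>J. J \<subset> M\<^sub>0 \<Longrightarrow> \<not> reduct_closed U P M\<^sub>0 J"
    using lower unfolding open_answer_set_iff[OF datalog(1)] by auto
  show "least \<subseteq> ground_regular ar (preds (P \<union> Q)) U"
    using least_subset low(1) ground_regular_mono[of "preds P" "preds (P \<union> Q)" ar U]
      ground_regular_mono[of "head_preds Q" "preds (P \<union> Q)" ar U]
    unfolding preds_Un preds_def[of Q] by blast
  have "reduct_closed U P least least"
    using reduct_closed_lower_cong[OF agree_least agree_least] low(2) by simp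
  moreover have "reduct_closed U Q least least"
    using reduct_closed_top_cong[OF agree_least] least_in_models by (simp add: models_def)
  ultimately show "reduct_closed U (P \<union> Q) least least"
    by (simp add: reduct_closed_Un)
  fix J assume J: "J \<subset> least"
  show "\<not> reduct_closed U (P \<union> Q) least J"
  proof
    assume cl: "reduct_closed U (P \<union> Q) least J"
    let ?J = "{a\<in>J. pred_of a \<notin> head_preds Q}"
    have "agree (- head_preds Q) J ?J" by (simp add: agree_def)
    then have "reduct_closed U P M\<^sub>0 ?J"
      using cl reduct_closed_lower_cong[OF _ agree_least] by (simp add: reduct_closed_Un)
    moreover have "?J \<subseteq> M\<^sub>0"
      using J agree_least by (auto simp: agree_def)
    ultimately have "M\<^sub>0 \<subseteq> J" using low(3) by blast
    moreover have "reduct_closed U Q M\<^sub>0 J"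
      using cl reduct_closed_top_cong[OF agree_least] by (simp add: reduct_closed_Un)
    ultimately have "least \<subseteq> J" by (auto simp: least_def models_def)
    with J show False by blast
  qed
qed

text \<open>A smaller model of the lower reduct, completed by the atoms of \<open>M\<close> over the
  head predicates of \<open>Q\<close>, would contradict the minimality of \<open>M\<close>.\<close>

lemma open_answer_set_restrict:
  assumes "open_answer_set ar (P \<union> Q) U M"
  shows "open_answer_set ar P U {a\<in>M. pred_of a \<notin> head_preds Q}" (is "open_answer_set _ _ _ ?M")
  unfolding open_answer_set_iff[OF datalog(1)]
proof (intro conjI allI impI universe_lower)
  have M: "M \<subseteq> ground_regular ar (preds (P \<union> Q)) U" "reduct_closed U (P \<union> Q) M M"
    "\<And>J. J \<subset> M \<Longrightarrow> \<not> reduct_closed U (P \<union> Q) M J"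
    using assms unfolding open_answer_set_iff[OF datalog(3)] by auto
  have agM: "agree (- head_preds Q) M ?M" by (simp add: agree_def)
  \<comment> \<open>The bound by all predicates would still admit extensional predicates of
    \<open>Q\<close> that do not occur in \<open>P\<close>; the bound by head predicates excludes
    them.\<close>
  have "M \<subseteq> ground_regular ar (head_preds (P \<union> Q)) U"
    using safe by (intro open_answer_set_heads[OF _ assms])
      (auto simp: safe_def respects_arity_Un constants_Un)
  then show "?M \<subseteq> ground_regular ar (preds P) U"
    by (auto simp: ground_regular_def preds_def head_preds_Un)
  show "reduct_closed U P ?M ?M"
    using M(2) reduct_closed_lower_cong[OF agM agM] by (simp add: reduct_closed_Un)
  fix J assume J: "J \<subset> ?M"
  show "\<not> reduct_closed U P ?M J"
  proof
    assume cl: "reduct_closed U P ?M J"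
    let ?J = "M \<inter> (J \<union> {a. pred_of a \<in> head_preds Q})"
    have "agree (- head_preds Q) ?J J" using J by (auto simp: agree_def)
    then have "reduct_closed U P M ?J"
      using cl reduct_closed_lower_cong[OF _ agM] by blast
    \<comment> \<open>\<open>?J\<close> is \<open>M\<close> cut down to a set that retains every
      ground head of \<open>Q\<close>.\<close>
    moreover have "reduct_closed U Q M ?J"
      using M(2) pred_of_ground_regular
      by (intro reduct_closed_restrict[OF safe(2)]) (auto simp: reduct_closed_Un)
    ultimately have "reduct_closed U (P \<union> Q) M ?J" by (simp add: reduct_closed_Un)
    moreover have "?J \<subset> M" using J by blast
    ultimately show False using M(3) by blast
  qed
qed

text \<open>The lower part of \<open>M\<close> is \<open>M\<^sub>0\<close>, so \<open>M\<close> is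
  in \<open>models\<close> and contains \<open>least\<close>. As \<open>M\<close> and
  \<open>least\<close> induce the same reduct, minimality of \<open>M\<close> forces
  equality.\<close>

lemma open_answer_set_unique:
  assumes M: "open_answer_set ar (P \<union> Q) U M"
    and unique: "\<And>N. open_answer_set ar P U N \<Longrightarrow> N = M\<^sub>0"
  shows "M = least"
proof -
  have eq: "{a\<in>M. pred_of a \<notin> head_preds Q} = M\<^sub>0"
    by (rule unique[OF open_answer_set_restrict[OF M]])
  have ag: "agree (- head_preds Q) M M\<^sub>0" unfolding eq[symmetric] by (simp add: agree_def)
  have cl: "reduct_closed U (P \<union> Q) M M" and min: "\<And>J. J \<subset> M \<Longrightarrow> \<not> reduct_closed U (P \<union> Q) M J"
    using M unfolding open_answer_set_iff[OF datalog(3)] by auto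
  have "M \<in> models"
    using cl eq reduct_closed_top_cong[OF ag] by (auto simp: models_def reduct_closed_Un)
  then have "least \<subseteq> M" by (auto simp: least_def)
  moreover have "reduct_closed U (P \<union> Q) M least"
    using open_answer_set_least reduct_closed_lower_cong[OF agree_least ag]
      reduct_closed_lower_cong[OF agree_least agree_least]
      reduct_closed_top_cong[OF ag] reduct_closed_top_cong[OF agree_least]
    unfolding open_answer_set_iff[OF datalog(3)] by (simp add: reduct_closed_Un)
  ultimately show ?thesis using min by blast
qed

text \<open>The restriction to \<open>preds Q\<close> is forced: a structure for \<open>Q\<close>
  has no atoms over other predicates, while \<open>M\<^sub>0\<close> may.\<close>

lemma minimal_model_eq:
  "minimal_model ar U Q (id_structure U \<union> M\<^sub>0) = id_structure U \<union> {a\<in>least. pred_of a \<in> preds Q}"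
    (is "_ = id_structure U \<union> ?R")
proof -
  let ?V = "id_structure U \<union> M\<^sub>0" and ?T = "id_structure U \<union> ?R"
  have id_pred: "pred_of a = Equality" if "a \<in> id_structure U" for a :: "('p, 'c, 'v) atom"
    using that by (auto simp: id_structure_def)
  \<comment> \<open>What the reduct of \<open>Q\<close> consults is extensional in \<open>Q\<close>,
    hence prescribed by the input.\<close>
  have nm: "nonmonotone_preds Q \<subseteq> edb Q" "nonmonotone_preds Q \<subseteq> - head_preds Q"
    using basic_datalog_nonmonotone[OF basic] nonmonotone_preds_subset[of Q] preds_edb by blast+
  have Eq_heads: "Equality \<notin> head_preds Q"
    using datalog(2) by (fastforce simp: head_preds_def head_atoms_def datalog_rule_def)
  then have edb_heads: "edb Q \<inter> head_preds Q = {}" by (auto simp: edb_def)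
  have edb_regular: "q \<in> preds Q" if "q \<in> edb Q" "q \<noteq> Equality" for q
    using that by (auto simp: edb_def preds_def)
  have least_regular: "pred_of a \<noteq> Equality" if "a \<in> least" for a
    using that least_subset lower_heads regular_ground_regular by blast
  have least_ground: "least \<subseteq> ground_regular ar UNIV U"
    using least_subset lower_heads ground_regular_mono[OF subset_UNIV] by blast
  have agR: "agree (edb Q) ?R M\<^sub>0"
    unfolding agree_def
  proof (intro allI impI)
    fix a :: "('p, 'c, 'v) atom" assume a: "pred_of a \<in> edb Q"
    then have "a \<in> least \<longleftrightarrow> a \<in> M\<^sub>0" using agree_least edb_heads by (auto simp: agree_def)
    then show "a \<in> ?R \<longleftrightarrow> a \<in> M\<^sub>0" using least_regular edb_regular[OF a] by auto
  qed
  have T: "?T \<in> models_over ar U Q ?V"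
    unfolding models_over_def
  proof (intro CollectI conjI)
    show "is_structure ar (preds Q) U ?T"
      unfolding is_structure_def using least_ground
      by (intro exI[of _ ?R]) (auto simp: ground_regular_def)
    \<comment> \<open>Passes from the reduct at \<open>M\<^sub>0\<close> to the reduct at
      \<open>?R\<close> itself, as the first-order reading requires.\<close>
    have "agree (preds Q) least ?R" by (simp add: agree_def)
    moreover have "agree (nonmonotone_preds Q) M\<^sub>0 ?R"
      using agR nm(1) by (auto simp: agree_def)
    ultimately have "reduct_closed U Q M\<^sub>0 least \<longleftrightarrow> reduct_closed U Q ?R ?R"
      by (rule reduct_closed_cong)
    then have "reduct_closed U Q ?R ?R"
      using least_in_models by (simp add: models_def)
    then show "fo_model U ?T Q"
      using fo_model_iff[OF safe(2), of ?R] least_regular by auto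
    show "restrict ?T (edb Q) = restrict ?V (edb Q)"
      using agR by (auto simp: restrict_def agree_def)
  qed
  have least_T: "?T \<subseteq> S" if "S \<in> models_over ar U Q ?V" for S
  proof -
    have "is_structure ar (preds Q) U S"
      using that by (simp add: models_over_def)
    then obtain R where R: "R \<subseteq> ground_regular ar (preds Q) U" and S: "S = id_structure U \<union> R"
      unfolding is_structure_def by blast
    have fo: "fo_model U (id_structure U \<union> R) Q"
      and res: "restrict (id_structure U \<union> R) (edb Q) = restrict ?V (edb Q)"
      using that unfolding S models_over_def by simp_all
    have reg: "\<forall>a\<in>R. pred_of a \<noteq> Equality" using R regular_ground_regular by blast
    have regM: "\<forall>a\<in>M\<^sub>0. pred_of a \<noteq> Equality" using lower_heads regular_ground_regular by blast
    have ag: "agree (edb Q) R M\<^sub>0"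
      unfolding agree_def
    proof (intro allI impI)
      fix a :: "('p, 'c, 'v) atom" assume "pred_of a \<in> edb Q"
      then have "a \<in> id_structure U \<union> R \<longleftrightarrow> a \<in> ?V"
        using res unfolding restrict_def by blast
      then show "a \<in> R \<longleftrightarrow> a \<in> M\<^sub>0" using reg regM id_pred by blast
    qed
    \<comment> \<open>Such an atom has an extensional predicate of \<open>Q\<close>, since
      \<open>M\<^sub>0\<close> avoids the head predicates of \<open>Q\<close>; the input then puts
      it into \<open>R\<close>.\<close>
    have low: "a \<in> R" if "a \<in> M\<^sub>0" "pred_of a \<in> preds Q" for a
      using ag lower_pred preds_edb that unfolding agree_def by blast
    \<comment> \<open>Adding \<open>M\<^sub>0\<close> changes nothing that \<open>Q\<close> can see
      and turns \<open>R\<close> into a member of \<open>models\<close>.\<close>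
    have "agree (preds Q) R (R \<union> M\<^sub>0)" using low by (auto simp: agree_def)
    moreover have "agree (nonmonotone_preds Q) R M\<^sub>0" using ag nm(1) by (rule agree_mono)
    ultimately have "reduct_closed U Q R R \<longleftrightarrow> reduct_closed U Q M\<^sub>0 (R \<union> M\<^sub>0)"
      by (rule reduct_closed_cong)
    then have "R \<union> M\<^sub>0 \<in> models"
      using fo fo_model_iff[OF safe(2) reg] by (simp add: models_def)
    then have "least \<subseteq> R \<union> M\<^sub>0" by (auto simp: least_def)
    then show ?thesis using low S by auto
  qed
  from T least_T show ?thesis by (rule minimal_model_eqI)
qed

text \<open>The atoms of \<open>least\<close> cut off in the minimal model lie in
  \<open>M\<^sub>0\<close>, and the union restores them.\<close>

lemma lfp_step:
  "(id_structure U \<union> M\<^sub>0) \<union> minimal_model ar U Q (id_structure U \<union> M\<^sub>0) = id_structure U \<union> least"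
proof -
  have "least \<subseteq> M\<^sub>0 \<union> {a\<in>least. pred_of a \<in> preds Q}"
    using least_subset pred_of_ground_regular by (fastforce simp: preds_def)
  then show ?thesis unfolding minimal_model_eq using lower_subset_least by auto
qed

end

section \<open>Induction on the strata\<close>

text \<open>For the disjointness, a head predicate of \<open>Q\<close> that is a head below violates
  uniqueness of its stratum; one that occurs only in bodies of a lower stratum is extensional there,
  and \<open>Q\<close> would have to precede that stratum.\<close>

lemma stratified_datalog_snocD:
  assumes "stratified_datalog (Ps @ [Q])"
  shows "stratified_datalog Ps" "basic_datalog Q" "head_preds Q \<inter> preds (\<Union>(set Ps)) = {}"
proof -
  let ?R = "Ps @ [Q]"
  have basic: "\<And>R. R \<in> set ?R \<Longrightarrow> basic_datalog R"
    and uniq: "\<And>q. q \<in> head_preds (\<Union>(set ?R)) \<Longrightarrow>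
      \<exists>!i. i < length ?R \<and> q \<in> head_preds (?R ! i)"
    and order: "\<And>i j. i < length ?R \<Longrightarrow> j < length ?R \<Longrightarrow>
      head_preds (?R ! i) \<inter> edb (?R ! j) \<noteq> {} \<Longrightarrow> i < j"
    using assms unfolding stratified_datalog_def by blast+
  have heads: "head_preds (\<Union>F) = (\<Union>R\<in>F. head_preds R)"
    and bodies: "body_preds (\<Union>F) = (\<Union>R\<in>F. body_preds R)" for F :: "('a, 'b, 'c) program set"
    unfolding head_preds_def body_preds_def head_atoms_def body_atoms_def by auto
  have nth: "?R ! i = Ps ! i" if "i < length Ps" for i using that by (simp add: nth_append)
  show "basic_datalog Q" using basic by simp
  show "stratified_datalog Ps"
    unfolding stratified_datalog_def
  proof (intro conjI ballI allI impI)
    show "basic_datalog R" if "R \<in> set Ps" for R using basic that by simp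
  next
    fix q assume q: "q \<in> head_preds (\<Union>(set Ps))"
    then obtain i where i: "i < length Ps" "q \<in> head_preds (Ps ! i)"
      unfolding heads by (auto simp: in_set_conv_nth)
    have "q \<in> head_preds (\<Union>(set ?R))" using q unfolding heads by auto
    note u = uniq[OF this]
    show "\<exists>!i. i < length Ps \<and> q \<in> head_preds (Ps ! i)"
    proof (rule ex1I[of _ i])
      show "j = i" if "j < length Ps \<and> q \<in> head_preds (Ps ! j)" for j
      proof -
        have "i < length ?R \<and> q \<in> head_preds (?R ! i)" "j < length ?R \<and> q \<in> head_preds (?R ! j)"
          using that i nth by auto
        with u show ?thesis by blast
      qed
    qed (use i in blast)
  next
    fix i j assume "i < length Ps" "j < length Ps" "head_preds (Ps ! i) \<inter> edb (Ps ! j) \<noteq> {}"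
    then show "i < j" using order[of i j] nth by simp
  qed
  show "head_preds Q \<inter> preds (\<Union>(set Ps)) = {}"
  proof (rule ccontr)
    assume "head_preds Q \<inter> preds (\<Union>(set Ps)) \<noteq> {}"
    then obtain q R where q: "q \<in> head_preds Q" and R: "R \<in> set Ps"
      "q \<in> head_preds R \<or> q \<in> body_preds R"
      unfolding preds_def heads bodies by blast
    then obtain j where j: "j < length Ps" and "Ps ! j = R"
      by (auto simp: in_set_conv_nth)
    with R consider "q \<in> head_preds (Ps ! j)" | "q \<in> edb (Ps ! j)" by (auto simp: edb_def)
    then show False
    proof cases
      case 1
      have "q \<in> head_preds (\<Union>(set ?R))" using q unfolding heads by auto
      note uniq[OF this]
      moreover have "j < length ?R \<and> q \<in> head_preds (?R ! j)"
        "length Ps < length ?R \<and> q \<in> head_preds (?R ! length Ps)"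
        using 1 j q nth by auto
      ultimately have "j = length Ps" by blast
      then show False using j by simp
    next
      case 2
      then have "length Ps < j" using order[of "length Ps" j] q j nth by auto
      then show False using j by simp
    qed
  qed
qed

text \<open>One witness carries both claims through the induction; the equivalence with
  \<open>N = M\<close> expresses existence and uniqueness together. Induction from the right matches
  the fold, which treats the top stratum last.\<close>

lemma stratified_open_answer_set:
  assumes "respects_arity ar (\<Union>(set Ps))" "stratified_datalog Ps" "universe (\<Union>(set Ps)) U"
  shows "\<exists>M. lfp_model ar U Ps (id_structure U) = id_structure U \<union> M \<and>
    (\<forall>N. open_answer_set ar (\<Union>(set Ps)) U N \<longleftrightarrow> N = M)"
  using assms
proof (induction Ps rule: rev_induct)
  case Nil
  have "open_answer_set ar {} U N \<longleftrightarrow> N = {}" for N :: "('a, 'b, 'c) atom set"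
    using Nil(3) by (auto simp: open_answer_set_iff reduct_closed_def ground_regular_def preds_def
        head_preds_def body_preds_def head_atoms_def body_atoms_def)
  then show ?case by (auto simp: lfp_model_def)
next
  case (snoc Q Ps)
  let ?P = "\<Union>(set Ps)"
  have PQ: "\<Union>(set (Ps @ [Q])) = ?P \<union> Q" by auto
  have ar: "respects_arity ar ?P" "respects_arity ar Q"
    using snoc.prems(1) unfolding PQ respects_arity_Un by auto
  have univ: "universe ?P U" "constants ?P \<subseteq> U" "constants Q \<subseteq> U"
    using snoc.prems(3) unfolding PQ universe_def constants_Un by auto
  note strat = stratified_datalog_snocD[OF snoc.prems(2)]
  obtain M where lfp: "lfp_model ar U Ps (id_structure U) = id_structure U \<union> M"
    and M: "\<forall>N. open_answer_set ar ?P U N \<longleftrightarrow> N = M"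
    using snoc.IH[OF ar(1) strat(1) univ(1)] by (elim exE conjE)
  have "\<forall>R\<in>set Ps. basic_datalog R"
    using strat(1) by (simp add: stratified_datalog_def)
  then have "\<forall>r\<in>?P. datalog_rule r" "\<forall>r\<in>Q. datalog_rule r"
    using strat(2) by (simp_all add: basic_datalog_def)
  then have safe: "safe ar U ?P" "safe ar U Q"
    using ar univ by (simp_all add: safe_def)
  interpret top_stratum ar U ?P Q M
    using snoc.prems(3) safe strat(2,3) M unfolding PQ by unfold_locales simp_all
  have "lfp_model ar U (Ps @ [Q]) (id_structure U) = id_structure U \<union> least"
    using lfp lfp_step by (simp add: lfp_model_def)
  moreover have "open_answer_set ar (?P \<union> Q) U N \<longleftrightarrow> N = least" for N
    using open_answer_set_least open_answer_set_unique M by blast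
  ultimately show ?case unfolding PQ by blast
qed

theorem corollary8p6:
  fixes ar :: "'p \<Rightarrow> nat"
    and Ps :: "('p, 'c, 'v) program list"
    and U :: "'c set"
  assumes "respects_arity ar (\<Union>(set Ps))"
    and "stratified_datalog Ps"
    and "universe (\<Union>(set Ps)) U"
  shows "(\<exists>!M. open_answer_set ar (\<Union>(set Ps)) U M) \<and>
    (\<forall>M. open_answer_set ar (\<Union>(set Ps)) U M \<longrightarrow>
       M = {a \<in> lfp_model ar U Ps (id_structure U). pred_of a \<noteq> Equality})"
proof -
  obtain M where lfp: "lfp_model ar U Ps (id_structure U) = id_structure U \<union> M"
    and M: "\<forall>N. open_answer_set ar (\<Union>(set Ps)) U N \<longleftrightarrow> N = M"
    using stratified_open_answer_set[OF assms] by (elim exE conjE)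
  \<comment> \<open>All atoms of \<open>M\<close> are regular, so filtering out equality atoms
    removes exactly \<open>id_structure U\<close>.\<close>
  have "M \<subseteq> ground_regular ar (preds (\<Union>(set Ps))) U"
    using M by (auto simp: open_answer_set_def)
  then have "M = {a \<in> lfp_model ar U Ps (id_structure U). pred_of a \<noteq> Equality}"
    unfolding lfp by (auto simp: id_structure_def dest: regular_ground_regular)
  then show ?thesis using M by auto
qed

end
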